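(* Let $F(z)=\sum_{k=0}^\infty b_k z^k\in\mathcal{B}$. Then \[ \sum_{k=1}^\infty k^2|b_k|^2r^{2k}\le \frac{27}{4}r^4,\qquad \sqrt{4/15}\le r\le\sqrt{1/3}. \] The inequality is sharp: equality holds for $F(z)=\frac{3\sqrt3}{4}z^2$.
   Context: $\mathbb{D}$ denotes the open unit disc. $\mathcal{B}$ is the class of functions $F$ analytic in $\mathbb{D}$ satisfying $|F'(z)|\le \frac{1}{1-|z|^2}$ for all $z\in\mathbb{D}$. For $F\in\mathcal{B}$ we write its Taylor expansion as $F(z)=\sum_{k=0}^\infty b_k z^k$. *)

theory Defs
  imports "HOL-Analysis.Analysis"
begin

definition bloch_class :: "(complex \<Rightarrow> complex) set" where
  "bloch_class = {F. F holomorphic_on ball 0 1 \<and>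
      (\<forall>z\<in>ball 0 1. norm (deriv F z) \<le> 1 / (1 - (norm z)^2))}"

definition taylor_coeff :: "(complex \<Rightarrow> complex) \<Rightarrow> nat \<Rightarrow> complex" where
  "taylor_coeff F k = (deriv ^^ k) F 0 / of_nat (fact k)"

end

theory Submission
  imports Defs "HOL-Complex_Analysis.Complex_Analysis"
begin

text \<open>
  Put \<open>f = F'\<close>, \<open>f(z) = \<Sum> a\<^sub>n z\<^sup>n\<close>. On \<open>|z|\<^sup>2 = 1/3\<close> one has \<open>|f| \<le> 3/2\<close>, hence
  \<open>\<Sum> |a\<^sub>n|\<^sup>2 / 3\<^sup>n \<le> 9/4\<close> by Parseval. This alone does not suffice for \<open>r\<^sup>2 < 1/3\<close>: it
  must be combined with \<open>|a\<^sub>0|\<^sup>2 + 4/27 |a\<^sub>1|\<^sup>2 \<le> 1\<close>, which limits the mass at index 0, and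
  with \<open>x = 3 r\<^sup>2\<close> the resulting elementary estimate needs exactly \<open>4/5 \<le> x \<le> 1\<close>.

  The estimate for \<open>a\<^sub>0, a\<^sub>1\<close> uses the Moebius invariance of the Bloch class: with
  \<open>\<phi>(w) = (w + c) / (1 + cnj c w)\<close>, the function \<open>2/3 (F \<circ> \<phi>)'\<close> is bounded by 1 on
  \<open>|w|\<^sup>2 < 1/3\<close>, so the Schwarz-Pick inequality on that disc applies at \<open>w = -c\<close>. The modulus
  of \<open>c\<close> is chosen so that \<open>|a\<^sub>0| = 3 sqrt 3 / 2 |c| (1 - |c|\<^sup>2)\<close>, the value for the
  extremal function \<open>3 sqrt 3 / 4 z\<^sup>2\<close> transported by a Moebius map, and its argument so that
  \<open>|a\<^sub>1 - 2 cnj c a\<^sub>0| = |a\<^sub>1| + 2 |c| |a\<^sub>0|\<close>.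
\<close>

section \<open>Moebius maps of the unit disc and the Schwarz-Pick inequality\<close>

lemma one_minus_cnj_mult_neq_0:
  fixes w z :: complex
  assumes "norm w < 1" and "norm z < 1"
  shows "1 - cnj w * z \<noteq> 0"
proof
  assume "1 - cnj w * z = 0"
  then have "norm (cnj w * z) = 1" by simp
  moreover have "norm (cnj w * z) < 1"
    using assms by (metis complex_mod_cnj mult_1 norm_mult_less)
  ultimately show False by simp
qed

lemma one_minus_cnj_mult_self: "1 - cnj c * c = of_real (1 - (norm c)\<^sup>2)"
  by (simp only: of_real_diff of_real_1 complex_norm_square mult.commute)

text \<open>Clearing the denominator leaves
  \<open>|1 - cnj w z|^2 - |z - w|^2 = (1 - |w|^2) (1 - |z|^2)\<close>. The quotient on the right is
  \<open>|phi'(z)| (1 - |z|^2)\<close> for the Moebius map \<open>phi\<close>, which is the source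
  of the invariance of the Bloch class.\<close>

lemma one_minus_norm_Moebius_function:
  assumes "norm w < 1" and "norm z < 1"
  shows "1 - (norm (Moebius_function 0 w z))\<^sup>2 =
         (1 - (norm w)\<^sup>2) * (1 - (norm z)\<^sup>2) / (norm (1 - cnj w * z))\<^sup>2"
proof -
  have "1 - cnj w * z \<noteq> 0" by (rule one_minus_cnj_mult_neq_0[OF assms])
  then have "(norm (1 - cnj w * z))\<^sup>2 \<noteq> 0" by simp
  moreover have "(norm (1 - cnj w * z))\<^sup>2 - (norm (z - w))\<^sup>2 = (1 - (norm w)\<^sup>2) * (1 - (norm z)\<^sup>2)"
    unfolding cmod_power2 by (simp add: power2_eq_square algebra_simps)
  ultimately show ?thesis
    by (simp add: Moebius_function_simple norm_divide power_divide field_simps)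
qed

lemma has_field_derivative_Moebius_function:
  assumes "1 - cnj w * z \<noteq> 0"
  shows "(Moebius_function 0 w has_field_derivative
           of_real (1 - (norm w)\<^sup>2) / (1 - cnj w * z)\<^sup>2) (at z)"
proof -
  have "((\<lambda>z. (z - w) / (1 - cnj w * z)) has_field_derivative
          ((1 - cnj w * z) - (z - w) * (- cnj w)) / ((1 - cnj w * z) * (1 - cnj w * z))) (at z)"
    using assms by (auto intro!: derivative_eq_intros)
  moreover have "(1 - cnj w * z) - (z - w) * (- cnj w) = of_real (1 - (norm w)\<^sup>2)"
    by (simp only: of_real_diff of_real_1 complex_norm_square) (simp add: algebra_simps)
  ultimately show ?thesis
    unfolding Moebius_function_simple[abs_def] by (simp only: power2_eq_square[of "1 - cnj w * z"])
qed

text \<open>Composing \<open>h\<close> with Moebius maps on both sides moves \<open>p\<close> and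
  \<open>h p\<close> to 0. The Schwarz lemma bounds the derivative of the composite there, and the
  chain rule translates this back.\<close>

lemma Schwarz_Pick:
  assumes hol: "h holomorphic_on ball 0 1"
    and bound: "\<And>z. norm z < 1 \<Longrightarrow> norm (h z) < 1"
    and p: "norm p < 1"
  shows "norm (deriv h p) * (1 - (norm p)\<^sup>2) \<le> 1 - (norm (h p))\<^sup>2"
proof -
  define q where "q = h p"
  define k where "k = Moebius_function 0 q \<circ> (h \<circ> Moebius_function 0 (- p))"
  have q: "norm q < 1" using bound p by (simp add: q_def)
  have mp: "Moebius_function 0 (- p) 0 = p" by (simp add: Moebius_function_simple)
  have "Moebius_function 0 (- p) ` ball 0 1 \<subseteq> ball 0 1"
    using Moebius_function_norm_lt_1 p by auto
  moreover have "Moebius_function 0 (- p) holomorphic_on ball 0 1"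
    using Moebius_function_holomorphic p by simp
  ultimately have hol1: "(h \<circ> Moebius_function 0 (- p)) holomorphic_on ball 0 1"
    using hol holomorphic_on_compose_gen by blast
  have "(h \<circ> Moebius_function 0 (- p)) ` ball 0 1 \<subseteq> ball 0 1"
    using Moebius_function_norm_lt_1[of "- p"] p bound by auto
  then have "k holomorphic_on ball 0 1"
    unfolding k_def using hol1 Moebius_function_holomorphic[OF q] holomorphic_on_compose_gen by blast
  moreover have "k 0 = 0"
    by (simp add: k_def mp q_def Moebius_function_eq_zero)
  moreover have "norm (k z) < 1" if "norm z < 1" for z
    using that p q by (simp add: k_def Moebius_function_norm_lt_1 bound)
  ultimately have le: "norm (deriv k 0) \<le> 1"
    using Schwarz_Lemma(2)[of k 0] by simp
  have dh: "(h has_field_derivative deriv h p) (at p)"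
    using hol p by (intro holomorphic_derivI[where S = "ball 0 1"]) auto
  have "(Moebius_function 0 (- p) has_field_derivative of_real (1 - (norm p)\<^sup>2)) (at 0)"
    using has_field_derivative_Moebius_function[of "- p" 0] by simp
  then have "(h \<circ> Moebius_function 0 (- p) has_field_derivative deriv h p * of_real (1 - (norm p)\<^sup>2)) (at 0)"
    using dh mp by (intro DERIV_chain) auto
  moreover have "(Moebius_function 0 q has_field_derivative
      of_real (1 - (norm q)\<^sup>2) / (1 - cnj q * q)\<^sup>2) (at ((h \<circ> Moebius_function 0 (- p)) 0))"
    using has_field_derivative_Moebius_function[OF one_minus_cnj_mult_neq_0[OF q q]]
    by (simp add: mp q_def)
  ultimately have "(k has_field_derivative of_real (1 - (norm q)\<^sup>2) / (1 - cnj q * q)\<^sup>2 *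
      (deriv h p * of_real (1 - (norm p)\<^sup>2))) (at 0)"
    unfolding k_def by (rule DERIV_chain[rotated])
  then have dk: "deriv k 0 = of_real (1 - (norm q)\<^sup>2) / (1 - cnj q * q)\<^sup>2 *
      (deriv h p * of_real (1 - (norm p)\<^sup>2))"
    by (rule DERIV_imp_deriv)
  note one_minus_cnj_mult_self[of q]
  moreover have q2: "1 - (norm q)\<^sup>2 > 0" using q by (simp add: abs_square_less_1)
  moreover have p2: "1 - (norm p)\<^sup>2 > 0" using p by (simp add: abs_square_less_1)
  ultimately have "norm (deriv k 0) = norm (deriv h p) * (1 - (norm p)\<^sup>2) / (1 - (norm q)\<^sup>2)"
    unfolding dk
    by (simp add: norm_mult norm_divide power2_eq_square del: of_real_diff)
  then show ?thesis using le q2 by (simp add: q_def)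
qed

section \<open>Parseval's inequality for Taylor coefficients\<close>

text \<open>Orthogonality of the \<open>N\<close>-th roots of unity. Sampling at these points
  replaces integration over the circle.\<close>

lemma discrete_Parseval:
  fixes c :: "nat \<Rightarrow> complex"
  assumes "N > 0"
  shows "(\<Sum>j<N. (norm (\<Sum>k<N. c k * cis (2 * pi * real j / N) ^ k))\<^sup>2) = N * (\<Sum>k<N. (norm (c k))\<^sup>2)"
proof -
  define \<omega> where "\<omega> = (\<lambda>k::nat. cis (2 * pi * real k / N))"
  \<comment> \<open>Exchanging the roles of \<open>j\<close> and \<open>k\<close> turns the sum over
    sample points into a geometric sum.\<close>
  have pw: "cis (2 * pi * real j / N) ^ k = \<omega> k ^ j" for j k :: nat
    by (simp add: \<omega>_def Complex.DeMoivre mult_ac)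
  have unit: "\<omega> k * cnj (\<omega> k) = 1" for k
    by (simp add: \<omega>_def cis_cnj cis_mult)
  have orth: "(\<Sum>j<N. (\<omega> k * cnj (\<omega> l)) ^ j) = (if k = l then of_nat N else 0)"
    if "k < N" "l < N" for k l
  proof (cases "k = l")
    case True
    then show ?thesis by (simp add: unit)
  next
    case False
    define z where "z = \<omega> k * cnj (\<omega> l)"
    have "\<omega> k ^ N = 1" for k
      using assms by (simp add: \<omega>_def Complex.DeMoivre)
    then have "z ^ N = 1"
      by (metis z_def complex_cnj_one complex_cnj_power mult_1 power_mult_distrib)
    moreover have "z \<noteq> 1"
    proof
      assume "z = 1"
      then have "\<omega> k = \<omega> l"
        using unit[of l] unfolding z_def by (metis mult.commute mult.assoc mult_1)
      moreover have "inj_on \<omega> {..<N}"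
        using Complex.bij_betw_roots_unity[OF assms] by (simp add: bij_betw_def \<omega>_def)
      ultimately show False
        using False that by (auto dest: inj_onD)
    qed
    ultimately have "(\<Sum>j<N. z ^ j) = 0"
      using geometric_sum[of z N] by simp
    then show ?thesis using False by (simp add: z_def)
  qed
  have "complex_of_real (\<Sum>j<N. (norm (\<Sum>k<N. c k * cis (2 * pi * real j / N) ^ k))\<^sup>2) =
      (\<Sum>j<N. \<Sum>k<N. \<Sum>l<N. c k * cnj (c l) * (\<omega> k * cnj (\<omega> l)) ^ j)"
    unfolding of_real_sum complex_norm_square pw
    by (simp add: sum_product power_mult_distrib mult_ac)
  also have "\<dots> = (\<Sum>k<N. \<Sum>l<N. c k * cnj (c l) * (\<Sum>j<N. (\<omega> k * cnj (\<omega> l)) ^ j))"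
    by (subst sum.swap, rule sum.cong[OF refl], subst sum.swap, simp add: sum_distrib_left)
  also have "\<dots> = (\<Sum>k<N. \<Sum>l<N. if k = l then of_nat N * (c k * cnj (c l)) else 0)"
    by (intro sum.cong refl) (simp add: orth)
  also have "\<dots> = of_real (N * (\<Sum>k<N. (norm (c k))\<^sup>2))"
    unfolding of_real_mult of_real_sum complex_norm_square by (simp add: sum_distrib_left)
  finally show ?thesis using of_real_eq_iff by blast
qed

text \<open>Taylor partial sums converge uniformly on the circle, so long ones are bounded there by
  \<open>M + e\<close>. The discrete identity carries this bound over to their coefficients, and
  then \<open>e\<close> tends to 0.\<close>

lemma coeff_square_sum_le:
  fixes f :: "complex \<Rightarrow> complex"
  assumes hol: "f holomorphic_on ball 0 R" and \<rho>: "0 \<le> \<rho>" "\<rho> < R"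
    and bound: "\<And>z. norm z = \<rho> \<Longrightarrow> norm (f z) \<le> M"
  defines "a \<equiv> \<lambda>n. (deriv ^^ n) f 0 / fact n"
  shows "summable (\<lambda>n. (norm (a n))\<^sup>2 * \<rho> ^ (2 * n))"
    and "(\<Sum>n. (norm (a n))\<^sup>2 * \<rho> ^ (2 * n)) \<le> M\<^sup>2"
proof -
  have sums: "(\<lambda>n. a n * z ^ n) sums f z" if "norm z < R" for z
    using holomorphic_power_series[OF hol, of z] that by (simp add: a_def)
  \<comment> \<open>Convergence at a strictly larger radius yields absolute convergence at
    \<open>\<rho>\<close>, the majorant for the Weierstrass test.\<close>
  obtain \<rho>' where \<rho>': "\<rho> < \<rho>'" "\<rho>' < R" using \<rho> dense by blast
  have "summable (\<lambda>n. norm (a n * of_real \<rho> ^ n))"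
    by (rule powser_insidea[where x = "of_real \<rho>'"])
       (use \<rho> \<rho>' sums[of "of_real \<rho>'"] in \<open>auto simp: sums_iff\<close>)
  then have summ: "summable (\<lambda>n. norm (a n) * \<rho> ^ n)"
    using \<rho> by (simp add: norm_mult norm_power)
  have "uniform_limit (sphere 0 \<rho>) (\<lambda>n z. \<Sum>i<n. a i * z ^ i) (\<lambda>z. \<Sum>i. a i * z ^ i) sequentially"
    by (rule Weierstrass_m_test[OF _ summ]) (simp add: norm_mult norm_power)
  then have unif: "uniform_limit (sphere 0 \<rho>) (\<lambda>n z. \<Sum>i<n. a i * z ^ i) f sequentially"
    by (rule uniform_limit_cong'[THEN iffD1, rotated -1])
       (use sums \<rho> in \<open>auto simp: sums_iff\<close>)
  have part: "(\<Sum>n<m. (norm (a n))\<^sup>2 * \<rho> ^ (2 * n)) \<le> (M + e)\<^sup>2" if e: "e > 0" for m e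
  proof -
    obtain N0 where N0: "\<And>n z. n \<ge> N0 \<Longrightarrow> norm z = \<rho> \<Longrightarrow> dist (\<Sum>i<n. a i * z ^ i) (f z) < e"
      using uniform_limitD[OF unif e] unfolding eventually_sequentially by (metis mem_sphere_0)
    \<comment> \<open>\<open>N\<close> has to cover the first \<open>m\<close> coefficients and
      reach the accuracy threshold \<open>N0\<close>; the successor makes it positive, as
      \<open>discrete_Parseval\<close> requires.\<close>
    define N where "N = Suc (max m N0)"
    have "N0 \<le> N" by (simp add: N_def)
    then have le: "norm (\<Sum>i<N. a i * z ^ i) \<le> M + e" if "norm z = \<rho>" for z
      using N0[of N z] bound[OF that] that norm_triangle_sub[of "\<Sum>i<N. a i * z ^ i" "f z"]
      by (simp add: dist_norm)
    have "N * (\<Sum>k<N. (norm (a k * of_real \<rho> ^ k))\<^sup>2) =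
        (\<Sum>j<N. (norm (\<Sum>k<N. a k * of_real \<rho> ^ k * cis (2 * pi * real j / N) ^ k))\<^sup>2)"
      by (rule discrete_Parseval[symmetric]) (simp add: N_def)
    also have "\<dots> \<le> (\<Sum>j<N. (M + e)\<^sup>2)"
    proof (intro sum_mono power_mono)
      fix j :: nat
      have "norm (of_real \<rho> * cis (2 * pi * real j / N)) = \<rho>" using \<rho> by (simp add: norm_mult)
      from le[OF this]
      show "norm (\<Sum>k<N. a k * of_real \<rho> ^ k * cis (2 * pi * real j / N) ^ k) \<le> M + e"
        by (simp add: power_mult_distrib mult.assoc)
    qed simp
    finally have "(\<Sum>k<N. (norm (a k * of_real \<rho> ^ k))\<^sup>2) \<le> (M + e)\<^sup>2"
      by (simp add: N_def)
    moreover have "(norm (a k * of_real \<rho> ^ k))\<^sup>2 = (norm (a k))\<^sup>2 * \<rho> ^ (2 * k)" for k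
      using \<rho> by (simp add: norm_mult norm_power power_mult_distrib power_mult mult.commute[of 2])
    moreover have "(\<Sum>n<m. (norm (a n))\<^sup>2 * \<rho> ^ (2 * n)) \<le> (\<Sum>n<N. (norm (a n))\<^sup>2 * \<rho> ^ (2 * n))"
      using \<rho> by (intro sum_mono2) (auto simp: N_def)
    ultimately show ?thesis by simp
  qed
  have part': "(\<Sum>n<m. (norm (a n))\<^sup>2 * \<rho> ^ (2 * n)) \<le> M\<^sup>2" for m
  proof (rule tendsto_lowerbound)
    show "((\<lambda>e. (M + e)\<^sup>2) \<longlongrightarrow> M\<^sup>2) (at_right 0)"
      by (auto intro!: tendsto_eq_intros)
    show "\<forall>\<^sub>F e in at_right 0. (\<Sum>n<m. (norm (a n))\<^sup>2 * \<rho> ^ (2 * n)) \<le> (M + e)\<^sup>2"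
      using part by (intro eventually_mono[OF eventually_at_right_less])
  qed simp
  show s: "summable (\<lambda>n. (norm (a n))\<^sup>2 * \<rho> ^ (2 * n))"
    using \<rho> by (intro summableI_nonneg_bounded[OF _ part']) auto
  show "(\<Sum>n. (norm (a n))\<^sup>2 * \<rho> ^ (2 * n)) \<le> M\<^sup>2"
    by (rule suminf_le_const[OF s part'])
qed

section \<open>Moebius invariance of the Bloch condition\<close>

text \<open>For \<open>f = F'\<close>, this is the derivative of \<open>F \<circ> Moebius_function 0 (- c)\<close>.\<close>

definition bloch_transform :: "complex \<Rightarrow> (complex \<Rightarrow> complex) \<Rightarrow> complex \<Rightarrow> complex" where
  "bloch_transform c f w =
     f (Moebius_function 0 (- c) w) * (of_real (1 - (norm c)\<^sup>2) / (1 + cnj c * w)\<^sup>2)"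

lemma holomorphic_on_bloch_transform:
  assumes "f holomorphic_on ball 0 1" and c: "norm c < 1"
  shows "bloch_transform c f holomorphic_on ball 0 1"
proof -
  have "Moebius_function 0 (- c) ` ball 0 1 \<subseteq> ball 0 1"
    using Moebius_function_norm_lt_1 c by auto
  moreover have "Moebius_function 0 (- c) holomorphic_on ball 0 1"
    using Moebius_function_holomorphic c by simp
  ultimately have "(f \<circ> Moebius_function 0 (- c)) holomorphic_on ball 0 1"
    using assms holomorphic_on_compose_gen by blast
  moreover have "(\<lambda>w. of_real (1 - (norm c)\<^sup>2) / (1 + cnj c * w)\<^sup>2) holomorphic_on ball 0 1"
    using one_minus_cnj_mult_neq_0[of "- c"] c by (intro holomorphic_intros) auto
  ultimately have "(\<lambda>w. (f \<circ> Moebius_function 0 (- c)) w *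
      (of_real (1 - (norm c)\<^sup>2) / (1 + cnj c * w)\<^sup>2)) holomorphic_on ball 0 1"
    by (rule holomorphic_on_mult)
  then show ?thesis
    by (simp add: bloch_transform_def[abs_def] o_def)
qed

text \<open>The chain-rule factor exactly compensates the change of the weight, so a bound on
  \<open>|f(z)| (1 - |z|^2)\<close> passes to the transform.\<close>

lemma norm_bloch_transform:
  assumes c: "norm c < 1" and w: "norm w < 1"
  shows "norm (bloch_transform c f w) * (1 - (norm w)\<^sup>2) =
         norm (f (Moebius_function 0 (- c) w)) * (1 - (norm (Moebius_function 0 (- c) w))\<^sup>2)"
proof -
  have "1 - (norm c)\<^sup>2 > 0" using c by (simp add: abs_square_less_1)
  then have "norm (bloch_transform c f w) =
      norm (f (Moebius_function 0 (- c) w)) * ((1 - (norm c)\<^sup>2) / (norm (1 + cnj c * w))\<^sup>2)"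
    by (simp add: bloch_transform_def norm_mult norm_divide norm_power del: of_real_diff)
  then show ?thesis
    using one_minus_norm_Moebius_function[of "- c" w] c w by simp
qed

text \<open>The Moebius map sends \<open>- c\<close> to 0, so the transform at \<open>- c\<close>
  sees the value and derivative of \<open>f\<close> at 0. The term \<open>2 * cnj c * f 0\<close>
  comes from differentiating \<open>1 / (1 + cnj c * w)^2\<close>.\<close>

lemma
  assumes c: "norm c < 1"
  shows bloch_transform_uminus: "bloch_transform c f (- c) = f 0 / of_real (1 - (norm c)\<^sup>2)"
    and has_field_derivative_bloch_transform_uminus:
      "(f has_field_derivative f') (at 0) \<Longrightarrow> (bloch_transform c f has_field_derivative
         (f' - 2 * cnj c * f 0) / of_real (1 - (norm c)\<^sup>2) ^ 2) (at (- c))"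
proof -
  define d where "d = complex_of_real (1 - (norm c)\<^sup>2)"
  have "1 - (norm c)\<^sup>2 > 0" using c by (simp add: abs_square_less_1)
  then have d0: "d \<noteq> 0" unfolding d_def of_real_eq_0_iff by simp
  have d: "1 + cnj c * (- c) = d" "1 - cnj (- c) * (- c) = d"
    using one_minus_cnj_mult_self[of c] by (simp_all add: d_def)
  have M0: "Moebius_function 0 (- c) (- c) = 0"
    by (rule Moebius_function_eq_zero)
  have fold: "bloch_transform c f =
      (\<lambda>w. (f \<circ> Moebius_function 0 (- c)) w * (d / (1 + cnj c * w)\<^sup>2))"
    by (simp add: bloch_transform_def[abs_def] d_def o_def)
  show "bloch_transform c f (- c) = f 0 / of_real (1 - (norm c)\<^sup>2)"
    unfolding fold d d_def[symmetric] using d0 by (simp add: M0 power2_eq_square)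
  assume f: "(f has_field_derivative f') (at 0)"
  have "(Moebius_function 0 (- c) has_field_derivative d / d\<^sup>2) (at (- c))"
    using has_field_derivative_Moebius_function[of "- c" "- c"] d d0 by (simp add: d_def)
  then have 1: "(f \<circ> Moebius_function 0 (- c) has_field_derivative f' * (d / d\<^sup>2)) (at (- c))"
    using f M0 by (intro DERIV_chain) auto
  have "((\<lambda>w. d / (1 + cnj c * w)\<^sup>2) has_field_derivative
      - (d * (2 * d * cnj c)) / (d\<^sup>2 * d\<^sup>2)) (at (- c))"
    by (rule derivative_eq_intros refl | use d0 d in \<open>simp; fail\<close>)+
  from DERIV_mult[OF 1 this, unfolded d]
  show "(bloch_transform c f has_field_derivative
      (f' - 2 * cnj c * f 0) / of_real (1 - (norm c)\<^sup>2) ^ 2) (at (- c))"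
    unfolding fold d_def[symmetric]
    by (rule DERIV_cong) (use d0 in \<open>simp add: M0 field_simps power2_eq_square\<close>)
qed

section \<open>The estimate for the first two coefficients of the derivative\<close>

text \<open>Rotate \<open>b\<close> into the direction of \<open>a\<close>. This supplies the
  argument of the Moebius parameter.\<close>

lemma ex_unit_norm_add_eq:
  fixes a b :: complex
  shows "\<exists>e. norm e = 1 \<and> norm (a + e * b) = norm a + norm b"
proof (cases "a = 0 \<or> b = 0")
  case True
  then show ?thesis by (intro exI[of _ 1]) auto
next
  case False
  define e where "e = sgn a * cnj (sgn b)"
  have "cnj (sgn b) * b = of_real (norm b)"
    using False by (simp add: sgn_eq complex_norm_square[symmetric] mult.commute[of "cnj b"] power2_eq_square)
  then have "a + e * b = sgn a * of_real (norm a + norm b)"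
    using False by (simp add: e_def mult.assoc sgn_eq field_simps)
  moreover have "norm e = 1"
    using False by (simp add: e_def norm_mult norm_sgn)
  ultimately show ?thesis
    using False by (intro exI[of _ e]) (simp add: norm_mult norm_sgn del: of_real_add)
qed

text \<open>Strictness of the bound makes the rescaled transform \<open>h\<close> map into the open
  disc, as \<open>Schwarz_Pick\<close> demands, and keeps the parameter \<open>s\<close> below
  1.\<close>

lemma bloch_derivative_coeffs_strict:
  assumes hol: "f holomorphic_on ball 0 1"
    and bound: "\<And>z. norm z < 1 \<Longrightarrow> norm (f z) * (1 - (norm z)\<^sup>2) < 1"
  shows "(norm (f 0))\<^sup>2 + 4/27 * (norm (deriv f 0))\<^sup>2 \<le> 1"
proof -
  define A where "A = deriv f 0"
  define B where "B = norm (f 0)"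
  have B: "0 \<le> B" "B < 1" using bound[of 0] by (auto simp: B_def)
  \<comment> \<open>\<open>s\<close> will be \<open>sqrt 3 * |c|\<close>. The cubic takes the values
    0 and 1 at the ends of the unit interval, so it attains \<open>B\<close>.\<close>
  have "\<exists>s\<ge>0. s \<le> 1 \<and> s * (3 - s\<^sup>2) / 2 = B"
    using B by (intro IVT') (auto intro!: continuous_intros)
  then obtain s where s: "0 \<le> s" "s \<le> 1" and sB: "s * (3 - s\<^sup>2) / 2 = B" by blast
  have s1: "s < 1" using s sB B by (cases "s = 1") auto
  define u where "u = s\<^sup>2 / 3"
  have ss: "s\<^sup>2 < 1" "0 \<le> s\<^sup>2" using s s1 by (simp_all add: abs_square_less_1)
  have u: "1 - u > 0" using ss by (simp add: u_def)
  have Bu: "B = 3/2 * s * (1 - u)" unfolding sB[symmetric] u_def by (simp add: field_simps)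
  obtain e where e: "norm e = 1" "norm (A + e * (of_real (2 * s / sqrt 3) * f 0)) =
      norm A + norm (of_real (2 * s / sqrt 3) * f 0)"
    using ex_unit_norm_add_eq by blast
  \<comment> \<open>The sign and the conjugate turn \<open>- 2 * cnj c * f 0\<close> into the
    summand that \<open>e\<close> aligns with \<open>A\<close>.\<close>
  define c where "c = - (of_real (s / sqrt 3) * cnj e)"
  have nc: "norm c = s / sqrt 3" using e s by (simp add: c_def norm_mult norm_divide)
  have nc2: "(norm c)\<^sup>2 = u" by (simp add: nc u_def power_divide)
  have c: "norm c < 1" using u nc2 by (metis abs_norm_cancel abs_square_less_1 diff_gt_0_iff_gt)
  have phase: "norm (A - 2 * cnj c * f 0) = norm A + 2 * s / sqrt 3 * B"
  proof -
    have "A - 2 * cnj c * f 0 = A + e * (of_real (2 * s / sqrt 3) * f 0)"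
      by (simp add: c_def algebra_simps)
    moreover have "norm (of_real (2 * s / sqrt 3) * f 0) = 2 * s / sqrt 3 * B"
      using s by (simp add: norm_mult norm_divide B_def)
    ultimately show ?thesis using e(2) by (simp only:)
  qed
  \<comment> \<open>Division by \<open>sqrt 3\<close> carries the unit disc to
    \<open>|w|^2 < 1/3\<close>, where the weight \<open>1 - |w|^2\<close> exceeds 2/3; hence the
    factor 2/3.\<close>
  define h where "h = (\<lambda>z. 2/3 * bloch_transform c f (z / of_real (sqrt 3)))"
  define p where "p = - (of_real (sqrt 3) * c)"
  have np: "norm p = s" by (simp add: p_def norm_mult nc)
  have pc: "p / of_real (sqrt 3) = - c" by (simp add: p_def)
  have third: "(norm (z / of_real (sqrt 3)))\<^sup>2 < 1/3" if "norm z < 1" for z :: complex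
    using that by (simp add: norm_divide power_divide abs_square_less_1)
  have in_ball: "norm (z / of_real (sqrt 3)) < 1" if "norm z < 1" for z :: complex
    by (rule power2_less_imp_less) (use third[OF that] in auto)
  have "(bloch_transform c f \<circ> (\<lambda>z. z / of_real (sqrt 3))) holomorphic_on ball 0 1"
    by (rule holomorphic_on_compose_gen[OF _ holomorphic_on_bloch_transform[OF hol c]])
       (use in_ball in \<open>auto intro!: holomorphic_intros\<close>)
  then have holh: "h holomorphic_on ball 0 1"
    unfolding h_def o_def by (intro holomorphic_intros)
  have boundh: "norm (h z) < 1" if z: "norm z < 1" for z
  proof -
    define w where "w = z / of_real (sqrt 3)"
    have w: "norm w < 1" "(norm w)\<^sup>2 < 1/3" using in_ball[OF z] third[OF z] by (auto simp: w_def)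
    have "norm (bloch_transform c f w) * (1 - (norm w)\<^sup>2) < 1"
      unfolding norm_bloch_transform[OF c w(1)]
      using bound Moebius_function_norm_lt_1[of "- c" w] c w by simp
    moreover have "norm (bloch_transform c f w) * (2/3) \<le> norm (bloch_transform c f w) * (1 - (norm w)\<^sup>2)"
      using w by (intro mult_left_mono) auto
    ultimately show ?thesis by (simp add: h_def w_def norm_mult)
  qed
  have "(f has_field_derivative A) (at 0)"
    unfolding A_def using hol by (intro holomorphic_derivI[where S = "ball 0 1"]) auto
  from has_field_derivative_bloch_transform_uminus[OF c this]
  have "(bloch_transform c f has_field_derivative (A - 2 * cnj c * f 0) / of_real (1 - u) ^ 2)
      (at (p / of_real (sqrt 3)))"
    by (simp add: pc nc2)
  moreover have "((\<lambda>z. z / of_real (sqrt 3)) has_field_derivative 1 / of_real (sqrt 3)) (at p)"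
    by (auto intro!: derivative_eq_intros)
  ultimately have "((\<lambda>z. bloch_transform c f (z / of_real (sqrt 3))) has_field_derivative
      (A - 2 * cnj c * f 0) / of_real (1 - u) ^ 2 * (1 / of_real (sqrt 3))) (at p)"
    by (rule DERIV_chain2)
  then have "(h has_field_derivative
      2/3 * ((A - 2 * cnj c * f 0) / of_real (1 - u) ^ 2 * (1 / of_real (sqrt 3)))) (at p)"
    unfolding h_def by (rule DERIV_cmult)
  then have "deriv h p =
      2/3 * ((A - 2 * cnj c * f 0) / of_real (1 - u) ^ 2 * (1 / of_real (sqrt 3)))"
    by (rule DERIV_imp_deriv)
  then have dh: "norm (deriv h p) = 2/3 * (norm (A - 2 * cnj c * f 0) / (1 - u)\<^sup>2 / sqrt 3)"
    using u by (simp only: norm_mult norm_divide norm_power norm_of_real) simp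
  \<comment> \<open>The choice of \<open>s\<close> pays off here: \<open>|h p| = |p| = s\<close>, so
    \<open>1 - s^2\<close> cancels from Schwarz-Pick and only \<open>|h'(p)| \<le> 1\<close>
    remains.\<close>
  have "norm (h p) = 2/3 * (B / (1 - u))"
    using u bloch_transform_uminus[OF c, of f]
    by (simp add: h_def pc nc2 norm_mult norm_divide B_def del: of_real_diff)
  also have "\<dots> = s"
    using u by (simp add: Bu field_simps)
  finally have "norm (h p) = s" .
  with Schwarz_Pick[OF holh boundh, of p]
  have "2/3 * (norm (A - 2 * cnj c * f 0) / (1 - u)\<^sup>2 / sqrt 3) * (1 - s\<^sup>2) \<le> 1 * (1 - s\<^sup>2)"
    using s1 by (simp add: dh np)
  then have "2/3 * (norm (A - 2 * cnj c * f 0) / (1 - u)\<^sup>2 / sqrt 3) \<le> 1"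
    using ss by (simp only: mult_le_cancel_right)
  then have "norm (A - 2 * cnj c * f 0) \<le> 3/2 * sqrt 3 * (1 - u)\<^sup>2"
    using u by (simp add: field_simps)
  then have "norm A \<le> 3/2 * sqrt 3 * (1 - u)\<^sup>2 - 2 * s / sqrt 3 * B"
    by (simp add: phase)
  also have "2 * s / sqrt 3 * B = sqrt 3 * s\<^sup>2 * (1 - u)"
    unfolding Bu by (simp add: field_simps power2_eq_square)
  also have "3/2 * sqrt 3 * (1 - u)\<^sup>2 - sqrt 3 * s\<^sup>2 * (1 - u) = 3/2 * sqrt 3 * ((1 - u) * (1 - s\<^sup>2))"
    by (simp add: u_def field_simps power2_eq_square)
  finally have "(norm A)\<^sup>2 \<le> (3/2 * sqrt 3 * ((1 - u) * (1 - s\<^sup>2)))\<^sup>2"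
    by (intro power_mono) auto
  then have A2: "4/27 * (norm A)\<^sup>2 \<le> ((1 - u) * (1 - s\<^sup>2))\<^sup>2"
    by (simp add: power_mult_distrib power_divide)
  \<comment> \<open>A polynomial in \<open>s\<close> alone remains; its sign is that of
    \<open>4 * s^2 - 15\<close>, negative because \<open>s^2 < 1\<close>, unless it
    vanishes.\<close>
  have "B\<^sup>2 + ((1 - u) * (1 - s\<^sup>2))\<^sup>2 - 1 = s\<^sup>2 * (1 - s\<^sup>2)\<^sup>2 * (4 * s\<^sup>2 - 15) / 36"
    unfolding Bu u_def by (simp add: power2_eq_square field_simps)
  also have "\<dots> \<le> 0"
    using ss by (intro divide_nonpos_pos mult_nonneg_nonpos) auto
  finally show ?thesis using A2 by (simp add: A_def B_def)
qed

text \<open>Multiplying \<open>f\<close> by \<open>sqrt x\<close> with \<open>x < 1\<close> makes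
  the bound strict and scales the left-hand side by \<open>x\<close>; then \<open>x\<close> may tend
  to 1.\<close>

lemma bloch_derivative_coeffs:
  assumes hol: "f holomorphic_on ball 0 1"
    and bound: "\<And>z. norm z < 1 \<Longrightarrow> norm (f z) * (1 - (norm z)\<^sup>2) \<le> 1"
  shows "(norm (f 0))\<^sup>2 + 4/27 * (norm (deriv f 0))\<^sup>2 \<le> 1"
proof (rule field_le_mult_one_interval)
  fix x :: real
  assume x: "0 < x" "x < 1"
  define l where "l = complex_of_real (sqrt x)"
  have l: "norm l = sqrt x" using x by (simp add: l_def)
  have "norm (l * f z) * (1 - (norm z)\<^sup>2) < 1" if "norm z < 1" for z
  proof -
    have "sqrt x * (norm (f z) * (1 - (norm z)\<^sup>2)) \<le> sqrt x * 1"
      using x by (intro mult_left_mono bound that) auto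
    also have "\<dots> < 1" using x by simp
    finally show ?thesis by (simp add: norm_mult l mult.assoc)
  qed
  moreover have "(\<lambda>z. l * f z) holomorphic_on ball 0 1"
    by (intro holomorphic_intros hol)
  ultimately have "(norm (l * f 0))\<^sup>2 + 4/27 * (norm (deriv (\<lambda>z. l * f z) 0))\<^sup>2 \<le> 1"
    by (intro bloch_derivative_coeffs_strict)
  moreover have "deriv (\<lambda>z. l * f z) 0 = l * deriv f 0"
    using hol by (intro deriv_cmult holomorphic_on_imp_differentiable_at[where s = "ball 0 1"]) auto
  ultimately show "x * ((norm (f 0))\<^sup>2 + 4/27 * (norm (deriv f 0))\<^sup>2) \<le> 1"
    using x by (simp add: norm_mult l power_mult_distrib algebra_simps)
qed

section \<open>From the coefficient bounds to the weighted sum\<close>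

lemma bloch_class_deriv:
  assumes "F \<in> bloch_class"
  shows "deriv F holomorphic_on ball 0 1"
    and "norm z < 1 \<Longrightarrow> norm (deriv F z) * (1 - (norm z)\<^sup>2) \<le> 1"
proof -
  show "deriv F holomorphic_on ball 0 1"
    using assms by (auto simp: bloch_class_def intro: holomorphic_deriv)
  assume z: "norm z < 1"
  then have "norm (deriv F z) \<le> 1 / (1 - (norm z)\<^sup>2)"
    using assms by (simp add: bloch_class_def)
  moreover have "1 - (norm z)\<^sup>2 > 0" using z by (simp add: abs_square_less_1)
  ultimately show "norm (deriv F z) * (1 - (norm z)\<^sup>2) \<le> 1"
    by (simp add: field_simps)
qed

text \<open>This identifies the sum to be estimated as a Parseval sum for \<open>F'\<close>, with
  the index shifted by one.\<close>

lemma Suc_mult_taylor_coeff: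
  "of_nat (Suc n) * taylor_coeff F (Suc n) = (deriv ^^ n) (deriv F) 0 / fact n"
  unfolding taylor_coeff_def funpow_Suc_right o_def fact_Suc of_nat_mult of_nat_fact of_nat_id
  by (simp del: of_nat_Suc)

text \<open>Given the first two coefficients, the sum is largest when the rest of the mass sits at index 2.\<close>

lemma weighted_suminf_le:
  fixes d :: "nat \<Rightarrow> real"
  assumes d: "\<And>n. 0 \<le> d n" and sum_d: "summable d" "suminf d \<le> 9/4"
    and d01: "d 0 + 4/9 * d 1 \<le> 1" and x: "4/5 \<le> x" "x \<le> 1"
  shows "summable (\<lambda>n. d n * x ^ n)" and "(\<Sum>n. d n * x ^ n) \<le> 9/4 * x"
proof -
  have le: "d n * x ^ n \<le> d n" for n
    using d x by (simp add: mult_left_le power_le_one)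
  show sum_dx: "summable (\<lambda>n. d n * x ^ n)"
    by (rule summable_comparison_test'[OF sum_d(1), of 0]) (use d x le in auto)
  define T where "T = (\<Sum>n. d (n + 2))"
  have T: "suminf d = T + d 0 + d 1"
    unfolding T_def using suminf_split_initial_segment[OF sum_d(1), of 2]
    by (simp add: numeral_2_eq_2)
  have "(\<Sum>n. d (n + 2) * x ^ (n + 2)) \<le> (\<Sum>n. x\<^sup>2 * d (n + 2))"
  proof (rule suminf_le)
    fix n
    have "d (n + 2) * x ^ n * x\<^sup>2 \<le> d (n + 2) * x\<^sup>2"
      using d x by (intro mult_right_mono mult_left_le power_le_one) auto
    then show "d (n + 2) * x ^ (n + 2) \<le> x\<^sup>2 * d (n + 2)"
      by (simp add: power_add power2_eq_square mult_ac)
  qed (use sum_dx sum_d summable_ignore_initial_segment[of _ 2] in \<open>blast intro: summable_mult\<close>)+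
  also have "\<dots> = x\<^sup>2 * T"
    unfolding T_def using sum_d summable_ignore_initial_segment[of d 2] by (simp add: suminf_mult)
  also have "\<dots> \<le> x\<^sup>2 * (9/4 - d 0 - d 1)"
    using T sum_d(2) by (intro mult_left_mono) auto
  finally have "(\<Sum>n. d n * x ^ n) \<le> x\<^sup>2 * (9/4 - d 0 - d 1) + d 0 + d 1 * x"
    using suminf_split_initial_segment[OF sum_dx, of 2] by (simp add: numeral_2_eq_2)
  \<comment> \<open>The excess over the target is a multiple of \<open>1 - x\<close>, so only the
    sign of the other factor is left to check.\<close>
  also have "\<dots> = 9/4 * x + (1 - x) * (d 0 - x * (9/4 - d 0 - d 1))"
    by (simp add: power2_eq_square field_simps)
  also have "\<dots> \<le> 9/4 * x"
  proof -
    \<comment> \<open>By \<open>d01\<close>, \<open>5/4 * d 0 \<le> 9/4 - d 0 - d 1\<close>; the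
      lower bound 4/5 on \<open>x\<close> offsets the factor 5/4.\<close>
    have "4/5 * (5/4 * d 0) \<le> x * (9/4 - d 0 - d 1)"
      using d01 x d[of 0] by (intro mult_mono) auto
    then show ?thesis using x by (simp add: mult_nonneg_nonpos)
  qed
  finally show "(\<Sum>n. d n * x ^ n) \<le> 9/4 * x" .
qed

lemma bloch_sum_le:
  assumes F: "F \<in> bloch_class" and r: "sqrt (4/15) \<le> r" "r \<le> sqrt (1/3)"
  defines "t \<equiv> \<lambda>k. real (Suc k)^2 * (norm (taylor_coeff F (Suc k)))^2 * r^(2 * Suc k)"
  shows "summable t" and "suminf t \<le> 27/4 * r^4"
proof -
  define f where "f = deriv F"
  define a where "a = (\<lambda>n. (deriv ^^ n) f 0 / fact n)"
  define \<rho> :: real where "\<rho> = 1 / sqrt 3"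
  define d where "d = (\<lambda>n. (norm (a n))\<^sup>2 * \<rho> ^ (2 * n))"
  note f = bloch_class_deriv[OF F, folded f_def]
  have \<rho>2: "\<rho>\<^sup>2 = 1/3" by (simp add: \<rho>_def power_divide)
  have "norm (f z) \<le> 3/2" if "norm z = \<rho>" for z
    using f(2)[of z] that by (simp add: \<rho>2) (simp add: \<rho>_def)
  then have d: "summable d" "suminf d \<le> 9/4"
    using coeff_square_sum_le[OF f(1), of \<rho> "3/2"]
    by (simp_all add: d_def a_def \<rho>_def power_divide)
  \<comment> \<open>\<open>d 1\<close> is \<open>|a 1|^2 / 3\<close>, which turns the constant 4/27
    into 4/9.\<close>
  have d01: "d 0 + 4/9 * d 1 \<le> 1"
    using bloch_derivative_coeffs[OF f] by (simp add: d_def a_def \<rho>2)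
  have r0: "0 < r" using r(1) by (rule less_le_trans[rotated]) simp
  define x where "x = 3 * r\<^sup>2"
  have "(sqrt (4/15))\<^sup>2 \<le> r\<^sup>2" using r by (intro power_mono) auto
  moreover have "r\<^sup>2 \<le> (sqrt (1/3))\<^sup>2" using r r0 by (intro power_mono) auto
  ultimately have x: "4/5 \<le> x" "x \<le> 1" by (simp_all add: x_def)
  \<comment> \<open>The sum starts at exponent 2, so \<open>r^2\<close> factors out; the 3 in
    \<open>x\<close> undoes the power of \<open>\<rho>\<close> contained in
    \<open>d\<close>.\<close>
  have t: "t = (\<lambda>n. r\<^sup>2 * (d n * x ^ n))"
  proof
    fix n
    have "real (Suc n) * norm (taylor_coeff F (Suc n)) = norm (a n)"
      using arg_cong[OF Suc_mult_taylor_coeff[of n F], of norm]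
      by (simp add: norm_mult a_def f_def del: of_nat_Suc)
    then have "t n = (norm (a n))\<^sup>2 * r ^ (2 * Suc n)"
      unfolding t_def by (simp flip: power_mult_distrib)
    moreover have "\<rho> ^ (2 * n) * x ^ n = r ^ (2 * n)"
      by (simp add: power_mult \<rho>2 x_def power_mult_distrib power_divide)
    ultimately show "t n = r\<^sup>2 * (d n * x ^ n)"
      by (simp add: d_def power2_eq_square mult_ac)
  qed
  have dx: "summable (\<lambda>n. d n * x ^ n)" "(\<Sum>n. d n * x ^ n) \<le> 9/4 * x"
    using weighted_suminf_le[OF _ d d01 x] by (simp_all add: d_def \<rho>_def)
  show "summable t" unfolding t by (intro summable_mult dx)
  have "suminf t \<le> r\<^sup>2 * (9/4 * x)"
    unfolding t by (subst suminf_mult[OF dx(1)]) (intro mult_left_mono dx zero_le_power2)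
  also have "\<dots> = 27/4 * r^4" by (simp add: x_def power2_eq_square power4_eq_xxxx)
  finally show "suminf t \<le> 27/4 * r^4" .
qed

section \<open>The extremal function\<close>

lemma deriv_cmult_square: "deriv (\<lambda>z::complex. c * z^2) = (\<lambda>z. 2 * c * z)"
  by (rule ext, rule DERIV_imp_deriv) (auto intro!: derivative_eq_intros)

text \<open>With \<open>u = |z|^2\<close> the squared condition reads
  \<open>27 * u * (1 - u)^2 \<le> 4\<close>. The difference factors as
  \<open>(4 - 3 * u) * (3 * u - 1)^2\<close>, whose double zero marks the circle
  \<open>u = 1/3\<close> where the bound is attained.\<close>

lemma extremal_in_bloch_class: "(\<lambda>z. complex_of_real (3 * sqrt 3 / 4) * z^2) \<in> bloch_class"
  unfolding bloch_class_def
proof (safe intro!: holomorphic_intros)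
  fix z :: complex
  assume "z \<in> ball 0 1"
  then have z: "norm z < 1" by simp
  define u where "u = (norm z)\<^sup>2"
  have u: "0 \<le> u" "u < 1" using z by (simp_all add: u_def abs_square_less_1)
  have "0 \<le> (4 - 3 * u) * (3 * u - 1)\<^sup>2" using u by (intro mult_nonneg_nonneg) auto
  also have "\<dots> = 4 - 27 * u * (1 - u)\<^sup>2" by (simp add: power2_eq_square algebra_simps)
  finally have "(3 * sqrt 3 / 2 * norm z * (1 - u))\<^sup>2 \<le> 1\<^sup>2"
    by (simp add: power_mult_distrib power_divide u_def)
  then have "3 * sqrt 3 / 2 * norm z * (1 - u) \<le> 1"
    by (rule power2_le_imp_le) simp
  then have "3 * sqrt 3 / 2 * norm z \<le> 1 / (1 - u)"
    using u by (simp add: pos_le_divide_eq)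
  moreover have "norm (deriv (\<lambda>z. complex_of_real (3 * sqrt 3 / 4) * z^2) z) = 3 * sqrt 3 / 2 * norm z"
    unfolding deriv_cmult_square by (simp add: norm_mult)
  ultimately show "norm (deriv (\<lambda>z. complex_of_real (3 * sqrt 3 / 4) * z^2) z) \<le> 1 / (1 - (norm z)\<^sup>2)"
    by (simp add: u_def)
qed

lemma taylor_coeff_cmult_square:
  "taylor_coeff (\<lambda>z. c * z^2) (Suc k) = (if k = 1 then c else 0)"
proof -
  have d2: "deriv (\<lambda>z::complex. 2 * c * z) = (\<lambda>z. 2 * c)"
    by (rule ext, rule DERIV_imp_deriv) (auto intro!: derivative_eq_intros)
  have const: "(deriv ^^ Suc n) (\<lambda>z::complex. 2 * c) = (\<lambda>z. 0)" for n
    by (induction n) simp_all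
  consider "k = 0" | "k = 1" | n where "k = Suc (Suc n)"
    by (metis One_nat_def not0_implies_Suc)
  then show ?thesis
  proof cases
    case 3
    then have "(deriv ^^ Suc k) (\<lambda>z. c * z^2) = (deriv ^^ Suc n) (deriv (deriv (\<lambda>z. c * z^2)))"
      by (simp only: funpow_Suc_right o_def)
    then show ?thesis
      unfolding taylor_coeff_def using 3 by (simp only: deriv_cmult_square d2 const) simp
  qed (simp_all add: taylor_coeff_def deriv_cmult_square d2)
qed

lemma suminf_cmult_square:
  fixes c :: complex and r :: real
  shows "(\<Sum>k. real (Suc k)^2 * (norm (taylor_coeff (\<lambda>z. c * z^2) (Suc k)))^2 * r^(2 * Suc k)) =
         4 * (norm c)\<^sup>2 * r^4"
proof -
  \<comment> \<open>The shifted index 1 stands for the exponent 2; all other terms vanish.\<close>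
  have "(\<Sum>k. real (Suc k)^2 * (norm (taylor_coeff (\<lambda>z. c * z^2) (Suc k)))^2 * r^(2 * Suc k)) =
      (\<Sum>k\<in>{1}. real (Suc k)^2 * (norm (taylor_coeff (\<lambda>z. c * z^2) (Suc k)))^2 * r^(2 * Suc k))"
    by (rule suminf_finite) (auto simp: taylor_coeff_cmult_square simp del: of_nat_Suc)
  then show ?thesis by (simp add: taylor_coeff_cmult_square)
qed

theorem theorem2:
  fixes F :: "complex \<Rightarrow> complex" and r :: real
  assumes "F \<in> bloch_class" and "sqrt (4/15) \<le> r" and "r \<le> sqrt (1/3)"
  shows "(summable (\<lambda>k. real (Suc k)^2 * (norm (taylor_coeff F (Suc k)))^2 * r^(2 * Suc k)) \<and>
         (\<Sum>k. real (Suc k)^2 * (norm (taylor_coeff F (Suc k)))^2 * r^(2 * Suc k)) \<le> 27/4 * r^4) \<and>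
         ((\<lambda>z. complex_of_real (3 * sqrt 3 / 4) * z^2) \<in> bloch_class \<and>
         (\<Sum>k. real (Suc k)^2 * (norm (taylor_coeff (\<lambda>z. complex_of_real (3 * sqrt 3 / 4) * z^2) (Suc k)))^2
                * r^(2 * Suc k)) = 27/4 * r^4)"
proof -
  have "4 * (norm (complex_of_real (3 * sqrt 3 / 4)))\<^sup>2 * r^4 = 27/4 * r^4"
    by (simp add: norm_mult norm_divide power_mult_distrib power_divide)
  then show ?thesis
    using bloch_sum_le[OF assms] extremal_in_bloch_class suminf_cmult_square by metis
qed

end
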